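(* Let $\gamma$ be a smooth strictly convex oval in $\mathbb R^2$, parametrised by its tangent angle $u\in\mathbb R/2\pi\mathbb Z$, so that $\gamma'(u)=\rho(u)\mathbf e(u)$ with $\rho(u)>0$. Define $$F(u)=\log\frac{\rho(u)}{\rho(u+\pi)},\qquad\text{so that } F(u+\pi)=-F(u).$$ Assume that $F$ and $F'$ have only finitely many zeros (on $\mathbb R/2\pi\mathbb Z$) and that every zero has finite order. Their zero sets and orders descend to $\mathbb R/\pi\mathbb Z$. Put $$\mathcal Z_{\mathrm E_{1/2}}=\{[u]\in\mathbb R/\pi\mathbb Z:F(u)=0\},\qquad \mathcal Z_{\mathrm{CSS}}=\{[u]\in\mathbb R/\pi\mathbb Z:F'(u)=0\},$$ $$\mathcal O_{\mathrm E_{1/2}}=\sum_{[u]\in\mathcal Z_{\mathrm E_{1/2}}}\mathrm{ord}_uF,\qquad \mathcal O_{\mathrm{CSS}}=\sum_{[u]\in\mathcal Z_{\mathrm{CSS}}}\mathrm{ord}_uF'.$$ Then $$\#\mathcal Z_{\mathrm{CSS}}\ge\#\mathcal Z_{\mathrm E_{1/2}},\qquad \mathcal O_{\mathrm{CSS}}\ge\mathcal O_{\mathrm E_{1/2}},\qquad \mathcal O_{\mathrm E_{1/2}}\equiv\mathcal O_{\mathrm{CSS}}\equiv1\pmod 2.$$ Moreover, $\mathcal Z_{\mathrm E_{1/2}}$ and $\mathcal Z_{\mathrm{CSS}}$ are precisely the singular-parameter sets of the Wigner caustic $\mathrm E_{1/2}$ and of the centre symmetry set $S$ of $\gamma$,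 respectively, and the orders occurring in $\mathcal O_{\mathrm E_{1/2}}$ and $\mathcal O_{\mathrm{CSS}}$ are the orders of vanishing of their respective signed speeds.
   Context: $\mathbf e(u)=(\cos u,\sin u)$. A smooth strictly convex oval here is a smooth simple closed curve with everywhere positive curvature; $\rho$ is its (smooth, positive, $2\pi$-periodic) radius of curvature. $\mathrm{ord}_u$ is the order of the zero at $u$. Parallel pairs of $\gamma$ are $(\gamma(u),\gamma(u+\pi))$. Put $\rho_+(u)=\rho(u)$, $\rho_-(u)=\rho(u+\pi)$, $\Delta_\gamma(u)=\gamma(u)-\gamma(u+\pi)$. The Wigner caustic is the midpoint curve $\mathrm E_{1/2}(u)=\frac12(\gamma(u)+\gamma(u+\pi))$, $[u]\in\mathbb R/\pi\mathbb Z$; its signed speed is the function $\ell$ with $\mathrm E_{1/2}'(u)=\ell(u)\mathbf e(u)$. The centre symmetry set is the envelope of the chord lines through $\gamma(u)$ and $\gamma(u+\pi)$, parametrised by $S(u)=\gamma(u+\pi)+\frac{\rho_-(u)}{\rho_+(u)+\rho_-(u)}\Delta_\gamma(u)$, $[u]\in\mathbb R/\pi\mathbb Z$; its signed speed is the function $\sigma$ with $dS/d\varphi=\sigma\,\Delta_\gamma/|\Delta_\gamma|$, where $\varphi$ is a local angle of $\Delta_\gamma$ (a regular parameter). Singular parameters are those at which the derivative of the parametrisation vanishes. *)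

theory Defs
  imports "HOL-Analysis.Analysis"
begin

definition unit_dir :: "real \<Rightarrow> real^2" where
  "unit_dir u = vector [cos u, sin u]"

(* C-infinity on an open set: D k is the k-th derivative of f. *)
definition smooth_on :: "real set \<Rightarrow> (real \<Rightarrow> 'a::real_normed_vector) \<Rightarrow> bool" where
  "smooth_on U f \<longleftrightarrow>
     (\<exists>D :: nat \<Rightarrow> real \<Rightarrow> 'a.
        (\<forall>u\<in>U. D 0 u = f u) \<and>
        (\<forall>k. \<forall>u\<in>U. (D k has_vector_derivative D (Suc k) u) (at u)))"

(* An oval parametrised by its tangent angle u. Since d(tangent angle)/d(arc length) = 1 / rho,
   positivity of the radius of curvature rho says that the curvature is everywhere positive.
   Injectivity on one period says that the closed curve is simple. *)
definition oval_by_tangent_angle :: "(real \<Rightarrow> real^2) \<Rightarrow> (real \<Rightarrow> real) \<Rightarrow> bool" where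
  "oval_by_tangent_angle \<gamma> \<rho> \<longleftrightarrow>
     smooth_on UNIV \<gamma> \<and> smooth_on UNIV \<rho> \<and>
     (\<forall>u. \<gamma> (u + 2 * pi) = \<gamma> u) \<and> (\<forall>u. \<rho> (u + 2 * pi) = \<rho> u) \<and>
     inj_on \<gamma> {0..<2 * pi} \<and>
     (\<forall>u. \<rho> u > 0) \<and>
     (\<forall>u. (\<gamma> has_vector_derivative \<rho> u *\<^sub>R unit_dir u) (at u))"

definition log_ratio :: "(real \<Rightarrow> real) \<Rightarrow> real \<Rightarrow> real" where
  "log_ratio \<rho> u = ln (\<rho> u / \<rho> (u + pi))"

(* The class of u in the quotient of the reals by the integer multiples of T. *)
definition period_class :: "real \<Rightarrow> real \<Rightarrow> real set" where
  "period_class T u = {v. \<exists>k::int. v = u + of_int k * T}"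

definition zero_classes :: "real \<Rightarrow> (real \<Rightarrow> real) \<Rightarrow> real set set" where
  "zero_classes T f = {period_class T u | u. f u = 0}"

definition finite_order :: "(real \<Rightarrow> real) \<Rightarrow> real \<Rightarrow> bool" where
  "finite_order f u \<longleftrightarrow> (\<exists>k. (deriv ^^ k) f u \<noteq> 0)"

(* Meaningful only for smooth f with finite_order f u. *)
definition zero_order :: "(real \<Rightarrow> real) \<Rightarrow> real \<Rightarrow> nat" where
  "zero_order f u = (LEAST k. (deriv ^^ k) f u \<noteq> 0)"

(* The common order at all representatives of the class c. *)
definition class_order :: "(real \<Rightarrow> real) \<Rightarrow> real set \<Rightarrow> nat" where
  "class_order f c = (THE n. \<forall>u\<in>c. zero_order f u = n)"

(* The zero set and the zero orders of f are well defined modulo T. *)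
definition zeros_descend :: "real \<Rightarrow> (real \<Rightarrow> real) \<Rightarrow> bool" where
  "zeros_descend T f \<longleftrightarrow>
     (\<forall>u. (f (u + T) = 0 \<longleftrightarrow> f u = 0) \<and>
          (f u = 0 \<longrightarrow> zero_order f (u + T) = zero_order f u))"

definition total_zero_order :: "real \<Rightarrow> (real \<Rightarrow> real) \<Rightarrow> nat" where
  "total_zero_order T f = (\<Sum>c\<in>zero_classes T f. class_order f c)"

definition parallel_chord :: "(real \<Rightarrow> real^2) \<Rightarrow> real \<Rightarrow> real^2" where
  "parallel_chord \<gamma> u = \<gamma> u - \<gamma> (u + pi)"

definition wigner_caustic :: "(real \<Rightarrow> real^2) \<Rightarrow> real \<Rightarrow> real^2" where
  "wigner_caustic \<gamma> u = (1/2) *\<^sub>R (\<gamma> u + \<gamma> (u + pi))"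

(* The point of contact of the chord line through gamma(u) and gamma(u + pi)
   with the envelope of these lines. *)
definition centre_symmetry_set ::
    "(real \<Rightarrow> real^2) \<Rightarrow> (real \<Rightarrow> real) \<Rightarrow> real \<Rightarrow> real^2" where
  "centre_symmetry_set \<gamma> \<rho> u =
     \<gamma> (u + pi) + (\<rho> (u + pi) / (\<rho> u + \<rho> (u + pi))) *\<^sub>R parallel_chord \<gamma> u"

definition singular_classes :: "real \<Rightarrow> (real \<Rightarrow> real^2) \<Rightarrow> real set set" where
  "singular_classes T c = {period_class T u | u. (c has_vector_derivative 0) (at u)}"

definition wigner_speed :: "(real \<Rightarrow> real^2) \<Rightarrow> (real \<Rightarrow> real) \<Rightarrow> bool" where
  "wigner_speed \<gamma> l \<longleftrightarrow>
     (\<forall>u. (wigner_caustic \<gamma> has_vector_derivative l u *\<^sub>R unit_dir u) (at u))"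

(* phi is a continuous angle function on the open set U of the nonvanishing vector field V. *)
definition local_angle ::
    "(real \<Rightarrow> real^2) \<Rightarrow> real set \<Rightarrow> (real \<Rightarrow> real) \<Rightarrow> bool" where
  "local_angle V U \<phi> \<longleftrightarrow>
     open U \<and> continuous_on U \<phi> \<and>
     (\<forall>u\<in>U. V u \<noteq> 0 \<and> V u = norm (V u) *\<^sub>R unit_dir (\<phi> u))"

definition regular_parameter :: "real set \<Rightarrow> (real \<Rightarrow> real) \<Rightarrow> bool" where
  "regular_parameter U \<phi> \<longleftrightarrow> smooth_on U \<phi> \<and> (\<forall>u\<in>U. deriv \<phi> u \<noteq> 0)"

(* dc/dphi = w at the parameter u, where phi is a regular parameter near u:
   c'(u) = phi'(u) w with phi'(u) nonzero. *)
definition has_derivative_wrt ::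
    "(real \<Rightarrow> real^2) \<Rightarrow> (real \<Rightarrow> real) \<Rightarrow> real^2 \<Rightarrow> real \<Rightarrow> bool" where
  "has_derivative_wrt c \<phi> w u \<longleftrightarrow>
     (\<exists>d. d \<noteq> 0 \<and> (\<phi> has_real_derivative d) (at u) \<and>
          (c has_vector_derivative d *\<^sub>R w) (at u))"

definition css_speed ::
    "(real \<Rightarrow> real^2) \<Rightarrow> (real \<Rightarrow> real) \<Rightarrow> (real \<Rightarrow> real) \<Rightarrow> bool" where
  "css_speed \<gamma> \<rho> \<sigma> \<longleftrightarrow>
     (\<forall>U \<phi>. local_angle (parallel_chord \<gamma>) U \<phi> \<longrightarrow>
        (\<forall>u\<in>U. has_derivative_wrt (centre_symmetry_set \<gamma> \<rho>) \<phi>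
           (\<sigma> u *\<^sub>R ((1 / norm (parallel_chord \<gamma> u)) *\<^sub>R parallel_chord \<gamma> u)) u))"

end

theory Submission
  imports Defs
begin

text \<open>\<open>F\<close> and \<open>F'\<close> change sign under translation by \<open>pi\<close>, while a smooth function changes sign
  exactly at its zeros of odd order; so both total orders are odd. Rolle's theorem on the \<open>n\<close> arcs
  between cyclically consecutive zeros of \<open>F\<close> gives \<open>n\<close> zeros of \<open>F'\<close> away from the zeros of \<open>F\<close>,
  and these make up for the loss of one order at each of the \<open>n\<close> zeros of \<open>F\<close> itself.

  The speed of the Wigner caustic is \<open>(exp F - 1) * \<rho> (u + pi) / 2\<close>. With \<open>\<Delta>\<close> the parallel chord
  one has \<open>S' = (1 / (1 + exp F))' \<Delta>\<close>, so the speed of the centre symmetry set is \<open>F'\<close> times a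
  smooth nonvanishing function, because strict convexity makes the chord direction rotate with
  positive angular speed.\<close>

section \<open>Smooth real functions\<close>

lemma smooth_on_has_deriv:
  fixes f :: "real \<Rightarrow> real"
  assumes "smooth_on UNIV f"
  shows "(f has_real_derivative deriv f x) (at x)" and "smooth_on UNIV (deriv f)"
proof -
  obtain D where D: "\<And>u. D 0 u = f u"
    "\<And>k u. (D k has_real_derivative D (Suc k) u) (at u)"
    using assms by (auto simp: smooth_on_def has_real_derivative_iff_has_vector_derivative)
  have "D 0 = f" using D(1) by auto
  then have der: "(f has_real_derivative D 1 u) (at u)" for u
    using D(2)[of 0] by simp
  then have eq: "deriv f = D 1"
    by (auto intro: DERIV_imp_deriv)
  show "(f has_real_derivative deriv f x) (at x)"
    using der eq by simp
  show "smooth_on UNIV (deriv f)"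
    unfolding smooth_on_def eq has_real_derivative_iff_has_vector_derivative[symmetric]
    by (rule exI[of _ "\<lambda>k. D (Suc k)"]) (use D(2) in auto)
qed

lemma smooth_on_const: "smooth_on UNIV (\<lambda>x. c)"
  unfolding smooth_on_def
  by (rule exI[of _ "\<lambda>k u. if k = 0 then c else 0"]) (auto intro!: derivative_eq_intros)

lemma smooth_on_shift:
  assumes "smooth_on UNIV f"
  shows "smooth_on UNIV (\<lambda>x. f (x + c))"
proof -
  obtain D where D: "\<And>u. D 0 u = f u"
    "\<And>k u. (D k has_vector_derivative D (Suc k) u) (at u)"
    using assms by (auto simp: smooth_on_def)
  have "((\<lambda>x. D k (x + c)) has_vector_derivative D (Suc k) (u + c)) (at u)" for k u
  proof -
    have "((\<lambda>x. x + c) has_vector_derivative 1) (at u)"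
      by (auto intro!: derivative_eq_intros)
    from vector_diff_chain_at[OF this D(2)] show ?thesis
      by (simp add: o_def)
  qed
  then show ?thesis
    unfolding smooth_on_def using D(1)
    by (intro exI[of _ "\<lambda>k x. D k (x + c)"]) auto
qed

lemma smooth_on_vec_nth:
  fixes f :: "real \<Rightarrow> real^'n"
  assumes "smooth_on U f"
  shows "smooth_on U (\<lambda>x. f x $ i)"
proof -
  obtain D where D: "\<And>u. u \<in> U \<Longrightarrow> D 0 u = f u"
    "\<And>k u. u \<in> U \<Longrightarrow> (D k has_vector_derivative D (Suc k) u) (at u)"
    using assms by (auto simp: smooth_on_def)
  show ?thesis
    unfolding smooth_on_def using D
    by (intro exI[of _ "\<lambda>k x. D k x $ i"])
      (auto intro: bounded_linear.has_vector_derivative[OF bounded_linear_vec_nth])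
qed

text \<open>A class of functions closed under differentiation consists of smooth functions, so closing
  the smooth functions under the operations below adds nothing new. This replaces all formulas
  for higher derivatives of products and quotients.\<close>

inductive smooth_gen :: "(real \<Rightarrow> real) \<Rightarrow> bool" where
  base: "smooth_on UNIV f \<Longrightarrow> smooth_gen f"
| sin: "smooth_gen sin"
| cos: "smooth_gen cos"
| add: "smooth_gen f \<Longrightarrow> smooth_gen g \<Longrightarrow> smooth_gen (\<lambda>x. f x + g x)"
| mult: "smooth_gen f \<Longrightarrow> smooth_gen g \<Longrightarrow> smooth_gen (\<lambda>x. f x * g x)"
| inverse: "smooth_gen f \<Longrightarrow> (\<And>x. f x \<noteq> 0) \<Longrightarrow> smooth_gen (\<lambda>x. inverse (f x))"
| sqrt: "smooth_gen f \<Longrightarrow> (\<And>x. f x > 0) \<Longrightarrow> smooth_gen (\<lambda>x. sqrt (f x))"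
| ln: "smooth_gen f \<Longrightarrow> (\<And>x. f x > 0) \<Longrightarrow> smooth_gen (\<lambda>x. ln (f x))"

text \<open>The derivative of each operation is built from the same operations: \<open>sqrt\<close>
  and \<open>ln\<close> bring in only an additional \<open>inverse\<close>, whose argument the
  positivity hypotheses keep away from zero. The induction therefore never leaves the class.\<close>

lemma smooth_gen_has_deriv:
  assumes "smooth_gen f"
  shows "\<exists>f'. smooth_gen f' \<and> (\<forall>x. (f has_real_derivative f' x) (at x))"
  using assms
proof induction
  case (base f)
  then show ?case
    using smooth_on_has_deriv[of f] smooth_gen.base by blast
next
  case sin
  show ?case
    by (intro exI[of _ cos]) (auto intro!: smooth_gen.cos DERIV_sin)
next
  case cos
  \<comment> \<open>The class has no rule for negation, so the minus sign enters as multiplication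
    by the constant -1.\<close>
  have "smooth_gen (\<lambda>x. (-1) * sin x)"
    by (intro smooth_gen.mult smooth_gen.base smooth_on_const smooth_gen.sin)
  then show ?case
    by (intro exI[of _ "\<lambda>x. - 1 * sin x"]) (auto intro!: derivative_eq_intros)
next
  case (add f g)
  then obtain f' g' where h: "smooth_gen f'" "smooth_gen g'"
    "\<And>x. (f has_real_derivative f' x) (at x)" "\<And>x. (g has_real_derivative g' x) (at x)"
    by blast
  then show ?case
    by (intro exI[of _ "\<lambda>x. f' x + g' x"]) (auto intro!: smooth_gen.add derivative_eq_intros)
next
  case (mult f g)
  then obtain f' g' where h: "smooth_gen f'" "smooth_gen g'"
    "\<And>x. (f has_real_derivative f' x) (at x)" "\<And>x. (g has_real_derivative g' x) (at x)"
    by blast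
  then show ?case using mult
    by (intro exI[of _ "\<lambda>x. f' x * g x + g' x * f x"])
      (auto intro!: smooth_gen.add smooth_gen.mult DERIV_mult)
next
  case (inverse f)
  then obtain f' where h: "smooth_gen f'" "\<And>x. (f has_real_derivative f' x) (at x)"
    by blast
  let ?g = "\<lambda>x. (-1) * (inverse (f x) * f' x * inverse (f x))"
  have "smooth_gen ?g"
    by (intro smooth_gen.mult smooth_gen.base[OF smooth_on_const] smooth_gen.inverse inverse h)
  moreover have "((\<lambda>x. inverse (f x)) has_real_derivative ?g x) (at x)" for x
    using inverse h by (auto intro!: derivative_eq_intros)
  ultimately show ?case by blast
next
  case (sqrt f)
  then obtain f' where h: "smooth_gen f'" "\<And>x. (f has_real_derivative f' x) (at x)"
    by blast
  let ?g = "\<lambda>x. (1/2) * (inverse (sqrt (f x)) * f' x)"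
  have nz: "f x \<noteq> 0" "sqrt (f x) \<noteq> 0" for x using sqrt.hyps(2)[of x] by simp_all
  have "smooth_gen ?g"
    by (intro smooth_gen.mult smooth_gen.base[OF smooth_on_const] smooth_gen.inverse
        smooth_gen.sqrt sqrt.hyps h nz)
  moreover have "((\<lambda>x. sqrt (f x)) has_real_derivative ?g x) (at x)" for x
    using sqrt.hyps(2)[of x] h(2)[of x] by (auto intro!: derivative_eq_intros)
  ultimately show ?case by blast
next
  case (ln f)
  then obtain f' where h: "smooth_gen f'" "\<And>x. (f has_real_derivative f' x) (at x)"
    by blast
  have "f x \<noteq> 0" for x using ln.hyps(2)[of x] by simp
  then have "smooth_gen (\<lambda>x. inverse (f x) * f' x)"
    by (intro smooth_gen.mult smooth_gen.inverse ln.hyps h)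
  moreover have "((\<lambda>x. ln (f x)) has_real_derivative inverse (f x) * f' x) (at x)" for x
    using ln.hyps(2)[of x] h(2)[of x] by (auto intro!: derivative_eq_intros simp: field_simps)
  ultimately show ?case by blast
qed

text \<open>Iterating \<open>deriv\<close> inside the class produces the whole sequence of
  derivatives that \<open>smooth_on\<close> asks for.\<close>

lemma smooth_gen_iff: "smooth_gen f \<longleftrightarrow> smooth_on UNIV f"
proof
  assume f: "smooth_gen f"
  have d: "smooth_gen (deriv g)" "(g has_real_derivative deriv g x) (at x)"
    if g: "smooth_gen g" for g x
  proof -
    obtain g' where g': "smooth_gen g'" "\<And>x. (g has_real_derivative g' x) (at x)"
      using smooth_gen_has_deriv[OF g] by blast
    then have "deriv g = g'" by (auto intro: DERIV_imp_deriv)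
    with g' show "smooth_gen (deriv g)" "(g has_real_derivative deriv g x) (at x)" by simp_all
  qed
  have "smooth_gen ((deriv ^^ k) f)" for k
    by (induction k) (auto intro: f d)
  then show "smooth_on UNIV f"
    unfolding smooth_on_def has_real_derivative_iff_has_vector_derivative[symmetric]
    by (intro exI[of _ "\<lambda>k. (deriv ^^ k) f"]) (auto intro: d)
qed (rule smooth_gen.base)

text \<open>Reading \<open>smooth_gen\<close> as \<open>smooth_on\<close> turns its introduction
  rules into closure rules for smooth functions; \<open>base\<close> is left out because it becomes
  trivial.\<close>

lemmas smooth_on_intros =
  smooth_on_const smooth_on_shift smooth_gen.intros(2-)[unfolded smooth_gen_iff]

lemma smooth_on_diff:
  fixes f g :: "real \<Rightarrow> real"
  assumes "smooth_on UNIV f" "smooth_on UNIV g"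
  shows "smooth_on UNIV (\<lambda>x. f x - g x)"
proof -
  have "smooth_on UNIV (\<lambda>x. f x + (-1) * g x)"
    by (intro smooth_on_intros assms)
  then show ?thesis by simp
qed

lemma smooth_on_divide:
  fixes f g :: "real \<Rightarrow> real"
  assumes "smooth_on UNIV f" "smooth_on UNIV g" "\<And>x. g x \<noteq> 0"
  shows "smooth_on UNIV (\<lambda>x. f x / g x)"
  unfolding divide_inverse by (intro smooth_on_intros assms)

lemma smooth_on_funpow_deriv:
  fixes f :: "real \<Rightarrow> real"
  assumes "smooth_on UNIV f"
  shows "smooth_on UNIV ((deriv ^^ k) f)"
  by (induction k) (auto intro: assms smooth_on_has_deriv)

lemma smooth_on_isCont:
  fixes f :: "real \<Rightarrow> real"
  assumes "smooth_on UNIV f"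
  shows "isCont f x"
  using smooth_on_has_deriv(1)[OF assms] DERIV_isCont by blast

text \<open>Made for angle functions, which live on an open set while their derivative is smooth on
  the whole line. The required sequence is \<open>g\<close> followed by the derivatives of
  \<open>f\<close>.\<close>

lemma smooth_on_primitive:
  fixes f :: "real \<Rightarrow> real"
  assumes f: "smooth_on UNIV f"
    and g: "\<And>u. u \<in> U \<Longrightarrow> (g has_real_derivative f u) (at u)"
  shows "smooth_on U g"
proof -
  obtain D where D: "\<And>u. D 0 u = f u"
    "\<And>k u. (D k has_vector_derivative D (Suc k) u) (at u)"
    using f by (auto simp: smooth_on_def)
  show ?thesis
    unfolding smooth_on_def
    by (rule exI[of _ "\<lambda>k. case k of 0 \<Rightarrow> g | Suc j \<Rightarrow> D j"])
      (use g D in \<open>auto split: nat.split simp: has_real_derivative_iff_has_vector_derivative\<close>)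
qed

section \<open>Orders of zeros\<close>

text \<open>A relational form of \<open>zero_order\<close> that also carries finiteness of the order
  and avoids \<open>LEAST\<close>. A point where \<open>f\<close> does not vanish has order
  0.\<close>

definition has_order :: "(real \<Rightarrow> real) \<Rightarrow> real \<Rightarrow> nat \<Rightarrow> bool" where
  "has_order f u n \<longleftrightarrow> (\<forall>k<n. (deriv ^^ k) f u = 0) \<and> (deriv ^^ n) f u \<noteq> 0"

lemma has_order_imp:
  assumes "has_order f u n"
  shows "finite_order f u" "zero_order f u = n"
  using assms unfolding has_order_def finite_order_def zero_order_def
  by (auto intro!: Least_equality simp: not_less[symmetric])

lemma finite_order_has_order: "finite_order f u \<Longrightarrow> has_order f u (zero_order f u)"
  unfolding has_order_def finite_order_def zero_order_def
  using LeastI_ex[of "\<lambda>k. (deriv ^^ k) f u \<noteq> 0"] not_less_Least[of _ "\<lambda>k. (deriv ^^ k) f u \<noteq> 0"]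
  by blast

lemma has_order_0: "has_order f u 0 \<longleftrightarrow> f u \<noteq> 0"
  by (simp add: has_order_def)

lemma has_order_Suc: "has_order f u (Suc n) \<longleftrightarrow> f u = 0 \<and> has_order (deriv f) u n"
  unfolding has_order_def
  by (auto simp: funpow_swap1 less_Suc_eq_0_disj simp del: funpow.simps
      simp: funpow_Suc_right)

text \<open>Differentiation loses exactly one order at each zero; this is the deficit that Rolle's
  theorem must later make up.\<close>

lemma zero_order_deriv:
  assumes "f u = 0" "finite_order f u"
  shows "zero_order f u = Suc (zero_order (deriv f) u)"
proof -
  have "has_order f u (zero_order f u)" by (rule finite_order_has_order[OF assms(2)])
  then show ?thesis
    by (cases "zero_order f u") (use assms in \<open>auto simp: has_order_0 has_order_Suc has_order_imp\<close>)
qed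

section \<open>Iterated derivatives of sums and products\<close>

lemma funpow_deriv_add:
  fixes f g :: "real \<Rightarrow> real"
  assumes "smooth_on UNIV f" "smooth_on UNIV g"
  shows "(deriv ^^ k) (\<lambda>x. f x + g x) u = (deriv ^^ k) f u + (deriv ^^ k) g u"
proof (induction k arbitrary: u)
  case (Suc k)
  have "(deriv ^^ k) (\<lambda>x. f x + g x) = (\<lambda>x. (deriv ^^ k) f x + (deriv ^^ k) g x)"
    using Suc by auto
  then show ?case
    by (auto intro!: DERIV_imp_deriv derivative_intros smooth_on_has_deriv
        smooth_on_funpow_deriv assms)
qed simp

lemma deriv_mult_smooth:
  fixes f g :: "real \<Rightarrow> real"
  assumes "smooth_on UNIV f" "smooth_on UNIV g"
  shows "deriv (\<lambda>x. g x * f x) = (\<lambda>x. deriv g x * f x + g x * deriv f x)"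
  by (rule ext, rule DERIV_imp_deriv)
    (auto intro!: derivative_eq_intros smooth_on_has_deriv assms)

text \<open>In the Leibniz expansion only the term with all derivatives on \<open>f\<close> survives
  at \<open>u\<close>. Splitting off one derivative per induction step avoids binomial coefficients:
  the \<open>deriv g x * f x\<close> part contributes a multiple of a lower derivative of
  \<open>f\<close>, which is zero.\<close>

lemma funpow_deriv_mult:
  fixes f g :: "real \<Rightarrow> real"
  assumes "smooth_on UNIV g" "smooth_on UNIV f" "\<And>k. k < n \<Longrightarrow> (deriv ^^ k) f u = 0"
  shows "(deriv ^^ n) (\<lambda>x. g x * f x) u = g u * (deriv ^^ n) f u"
  using assms
proof (induction n arbitrary: f g)
  case (Suc n)
  note d = smooth_on_has_deriv(2)
  have "(deriv ^^ n) (deriv f) u = (deriv ^^ Suc n) f u"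
    by (simp only: funpow_Suc_right o_def)
  moreover have "(deriv ^^ k) (deriv f) u = 0" if "k < n" for k
    using Suc(4)[of "Suc k"] that by (simp add: funpow_swap1)
  moreover have "(deriv ^^ Suc n) (\<lambda>x. g x * f x) u
      = (deriv ^^ n) (\<lambda>x. deriv g x * f x + g x * deriv f x) u"
    using deriv_mult_smooth[OF Suc(3,2)] by (simp only: funpow_Suc_right o_def)
  moreover have "\<dots> = (deriv ^^ n) (\<lambda>x. deriv g x * f x) u + (deriv ^^ n) (\<lambda>x. g x * deriv f x) u"
    by (intro funpow_deriv_add smooth_on_intros d Suc)
  ultimately show ?case
    using Suc.IH[OF d[OF Suc(2)] Suc(3)] Suc.IH[OF Suc(2) d[OF Suc(3)]] Suc(4)
    by simp
qed simp

text \<open>This transfers orders from \<open>F\<close> and its derivative to the signed speeds,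
  which differ from simpler functions by nonvanishing smooth factors.\<close>

lemma has_order_mult:
  fixes f g :: "real \<Rightarrow> real"
  assumes "smooth_on UNIV g" "smooth_on UNIV f" "g u \<noteq> 0" "has_order f u n"
  shows "has_order (\<lambda>x. g x * f x) u n"
  using assms(4) funpow_deriv_mult[OF assms(1,2)] assms(3)
  by (simp add: has_order_def)

section \<open>Antiperiodic functions and their derivatives\<close>

lemma deriv_antiperiodic:
  fixes f :: "real \<Rightarrow> real"
  assumes "smooth_on UNIV f" "\<And>x. f (x + T) = - f x"
  shows "deriv f (x + T) = - deriv f x"
proof -
  have "((\<lambda>x. f (x + T)) has_real_derivative deriv f (x + T)) (at x)"
    using smooth_on_has_deriv(1)[OF assms(1), of "x + T"] by (simp add: DERIV_shift)
  moreover have "((\<lambda>x. - f x) has_real_derivative - deriv f x) (at x)"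
    by (intro derivative_intros smooth_on_has_deriv assms)
  ultimately show ?thesis using assms(2) by (simp add: DERIV_unique)
qed

text \<open>Every iterated derivative inherits the sign change under translation, so the same
  derivatives vanish at a point and at its translate.\<close>

lemma antiperiodic_zeros_descend:
  fixes f :: "real \<Rightarrow> real"
  assumes "smooth_on UNIV f" "\<And>x. f (x + T) = - f x"
  shows "zeros_descend T f"
proof -
  have "(deriv ^^ k) f (x + T) = - (deriv ^^ k) f x" for k x
    by (induction k arbitrary: x)
      (auto intro!: deriv_antiperiodic smooth_on_funpow_deriv assms simp: assms(2))
  then show ?thesis
    by (simp add: zeros_descend_def zero_order_def assms(2))
qed

section \<open>Counting zeros modulo a period\<close>

lemma period_class_refl: "u \<in> period_class T u"
  unfolding period_class_def by (auto intro: exI[of _ 0])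

lemma period_class_shift: "period_class T (u + of_int k * T) = period_class T u"
proof -
  have "\<exists>j. u + of_int k * T + of_int i * T = u + of_int j * T" for i
    by (rule exI[of _ "k + i"]) (simp add: algebra_simps)
  moreover have "\<exists>j. u + of_int i * T = u + of_int k * T + of_int j * T" for i
    by (rule exI[of _ "i - k"]) (simp add: algebra_simps)
  ultimately show ?thesis
    unfolding period_class_def by fastforce
qed

lemma inj_on_period_class:
  assumes "T > 0"
  shows "inj_on (period_class T) {a..<a + T}"
proof
  fix x y assume xy: "x \<in> {a..<a + T}" "y \<in> {a..<a + T}" "period_class T x = period_class T y"
  then obtain k :: int where k: "x = y + of_int k * T"
    using period_class_refl[of x T] by (auto simp: period_class_def)
  then have "\<bar>of_int k * T\<bar> < T" using xy by auto
  then have "\<bar>of_int k :: real\<bar> < 1" using assms by (simp add: abs_mult)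
  then have "k = 0" by linarith
  then show "x = y" using k by simp
qed

lemma zeros_descend_int:
  assumes "zeros_descend T f" "f u = 0"
  shows "f (u + of_int k * T) = 0 \<and> zero_order f (u + of_int k * T) = zero_order f u"
proof (induction k rule: int_induct[where k = 0])
  case base
  then show ?case using assms by simp
next
  case (step1 i)
  then show ?case
    using assms(1)[unfolded zeros_descend_def, rule_format, of "u + of_int i * T"]
    by (simp add: algebra_simps)
next
  case (step2 i)
  then show ?case
    using assms(1)[unfolded zeros_descend_def, rule_format, of "u + of_int (i - 1) * T"]
    by (simp add: algebra_simps)
qed

text \<open>Counting classes becomes counting points in a half-open window. Its left end
  \<open>a\<close> stays free: the parity argument wants \<open>a\<close> off the zero set, the
  Rolle argument wants it to be a zero.\<close>

lemma zero_classes_eq: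
  assumes "T > 0" "zeros_descend T f"
  shows "zero_classes T f = period_class T ` {x \<in> {a..<a + T}. f x = 0}"
proof -
  have "\<exists>x\<in>{a..<a + T}. f x = 0 \<and> period_class T x = period_class T u" if "f u = 0" for u
  proof -
    \<comment> \<open>The floor counts the whole periods between \<open>a\<close> and
      \<open>u\<close>; removing them moves \<open>u\<close> into the window.\<close>
    define k where "k = - \<lfloor>(u - a) / T\<rfloor>"
    have "of_int (-k) \<le> (u - a) / T" "(u - a) / T < of_int (-k) + 1"
      unfolding k_def by linarith+
    then have "u + of_int k * T \<in> {a..<a + T}"
      using assms(1) by (simp add: field_simps)
    then show ?thesis
      using zeros_descend_int[OF assms(2) that, of k] period_class_shift[of T u k] by blast
  qed
  then have "zero_classes T f \<subseteq> period_class T ` {x \<in> {a..<a + T}. f x = 0}"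
    unfolding zero_classes_def by blast
  moreover have "period_class T ` {x \<in> {a..<a + T}. f x = 0} \<subseteq> zero_classes T f"
    unfolding zero_classes_def by blast
  ultimately show ?thesis by (rule antisym)
qed

lemma class_order_eq:
  assumes "zeros_descend T f" "f u = 0"
  shows "class_order f (period_class T u) = zero_order f u"
  unfolding class_order_def
proof (rule the_equality)
  show "\<forall>v\<in>period_class T u. zero_order f v = zero_order f u"
    using zeros_descend_int[OF assms] by (auto simp: period_class_def)
qed (use period_class_refl in metis)

lemma card_zero_classes_eq:
  assumes "T > 0" "zeros_descend T f"
  shows "card (zero_classes T f) = card {x \<in> {a..<a + T}. f x = 0}"
  unfolding zero_classes_eq[OF assms, of a]
  by (intro card_image inj_on_subset[OF inj_on_period_class[OF assms(1)]]) auto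

lemma total_zero_order_eq:
  assumes "T > 0" "zeros_descend T f"
  shows "total_zero_order T f = (\<Sum>x | x \<in> {a..<a + T} \<and> f x = 0. zero_order f x)"
proof -
  have "inj_on (period_class T) {x \<in> {a..<a + T}. f x = 0}"
    by (intro inj_on_subset[OF inj_on_period_class[OF assms(1)]]) auto
  then show ?thesis
    unfolding total_zero_order_def zero_classes_eq[OF assms, of a]
    by (auto simp: sum.reindex class_order_eq[OF assms(2)] intro!: sum.cong)
qed

lemma finite_zeros:
  assumes "T > 0" "finite (zero_classes T f)"
  shows "finite {x \<in> {a..<a + T}. f x = 0}"
proof (rule finite_imageD)
  show "finite (period_class T ` {x \<in> {a..<a + T}. f x = 0})"
    by (rule finite_subset[OF _ assms(2)]) (auto simp: zero_classes_def)
  show "inj_on (period_class T) {x \<in> {a..<a + T}. f x = 0}"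
    by (intro inj_on_subset[OF inj_on_period_class[OF assms(1)]]) auto
qed

section \<open>Parity\<close>

text \<open>Taylor's formula with its first \<open>n\<close> terms zero leaves \<open>f x\<close>
  equal to the \<open>n\<close>-th derivative at an intermediate point times a positive multiple of
  \<open>(x - z) ^ n\<close>. By continuity that derivative keeps the sign it has at
  \<open>z\<close>.\<close>

lemma sgn_near_zero:
  fixes f :: "real \<Rightarrow> real"
  assumes "smooth_on UNIV f" "has_order f z n"
  obtains e s where "e > 0" "s \<noteq> 0"
    "\<And>x. x \<noteq> z \<Longrightarrow> \<bar>x - z\<bar> < e \<Longrightarrow> sgn (f x) = s * sgn (x - z) ^ n"
proof -
  let ?d = "\<lambda>k. (deriv ^^ k) f"
  define s where "s = sgn (?d n z)"
  have "isCont (?d n) z" by (intro smooth_on_isCont smooth_on_funpow_deriv assms)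
  moreover have nz: "?d n z \<noteq> 0" using assms(2) by (simp add: has_order_def)
  ultimately obtain e where e: "e > 0" "\<And>y. \<bar>y - z\<bar> < e \<Longrightarrow> \<bar>?d n y - ?d n z\<bar> < \<bar>?d n z\<bar>"
    unfolding continuous_at_eps_delta dist_real_def by (metis zero_less_abs_iff)
  have "sgn (f x) = s * sgn (x - z) ^ n" if x: "x \<noteq> z" "\<bar>x - z\<bar> < e" for x
  proof -
    obtain t where t: "\<bar>t - z\<bar> < e" "f x = ?d n t / fact n * (x - z) ^ n"
    \<comment> \<open>Taylor's theorem is applied only for positive \<open>n\<close>; for order 0
      the point \<open>x\<close> itself serves as \<open>t\<close>.\<close>
    proof (cases "n = 0")
      case True
      then show ?thesis using that[of x] x by simp
    next
      case False
      let ?a = "min x z - 1" and ?b = "max x z + 1"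
      have "\<exists>t. (if x < z then x < t \<and> t < z else z < t \<and> t < x) \<and>
        f x = (\<Sum>m<n. (?d m z / fact m) * (x - z) ^ m) + (?d n t / fact n) * (x - z) ^ n"
        by (rule Taylor[where a = ?a and b = ?b])
          (use False x in \<open>auto intro!: smooth_on_has_deriv smooth_on_funpow_deriv assms(1)\<close>)
      moreover have "(\<Sum>m<n. (?d m z / fact m) * (x - z) ^ m) = 0"
        using assms(2) by (auto simp: has_order_def)
      ultimately obtain t where "if x < z then x < t \<and> t < z else z < t \<and> t < x"
        "f x = ?d n t / fact n * (x - z) ^ n" by auto
      then show ?thesis using that[of t] x by (auto split: if_splits)
    qed
    have "sgn (?d n t) = s"
      using e(2)[OF t(1)] nz unfolding s_def by (auto simp: sgn_if abs_if split: if_splits)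
    then show ?thesis
      by (simp add: t(2) sgn_mult sgn_divide power_sgn)
  qed
  moreover have "s \<noteq> 0" using nz by (simp add: s_def sgn_0_0)
  ultimately show ?thesis using that[of e s] e(1) by blast
qed

lemma sgn_eq_if_no_zero:
  fixes f :: "real \<Rightarrow> real"
  assumes "\<And>t. isCont f t" "x \<le> y" "\<And>t. x \<le> t \<Longrightarrow> t \<le> y \<Longrightarrow> f t \<noteq> 0"
  shows "sgn (f x) = sgn (f y)"
proof (rule ccontr)
  assume "sgn (f x) \<noteq> sgn (f y)"
  then have "f x \<le> 0 \<and> 0 \<le> f y \<or> f y \<le> 0 \<and> 0 \<le> f x"
    by (auto simp: sgn_if split: if_splits)
  then show False
    using IVT[of f x 0 y] IVT2[of f y 0 x] assms by blast
qed

text \<open>Induction on the number of zeros: remove a small neighbourhood of one zero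
  \<open>z\<close>. Each remaining side has fewer zeros, and crossing \<open>z\<close> multiplies
  the sign by -1 to the order of \<open>z\<close>.\<close>

lemma sgn_zero_count:
  fixes f :: "real \<Rightarrow> real"
  assumes f: "smooth_on UNIV f" and xy: "x < y" "f x \<noteq> 0" "f y \<noteq> 0"
    and fin: "finite {t \<in> {x<..<y}. f t = 0}"
    and ord: "\<And>t. f t = 0 \<Longrightarrow> finite_order f t"
  shows "sgn (f y) = (-1) ^ (\<Sum>t | t \<in> {x<..<y} \<and> f t = 0. zero_order f t) * sgn (f x)"
  using xy fin
proof (induction "card {t \<in> {x<..<y}. f t = 0}" arbitrary: x y rule: less_induct)
  case less
  let ?Z = "\<lambda>x y. {t \<in> {x<..<y}. f t = 0}"
  show ?case
  proof (cases "?Z x y = {}")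
    case True
    have "f t \<noteq> 0" if "x \<le> t" "t \<le> y" for t
      using that less.prems True by (cases "t = x \<or> t = y") auto
    then have "sgn (f x) = sgn (f y)"
      using sgn_eq_if_no_zero[of f x y] less.prems smooth_on_isCont[OF f] by simp
    moreover have "(\<Sum>t | t \<in> {x<..<y} \<and> f t = 0. zero_order f t) = 0"
      using True by (simp only: sum.empty)
    ultimately show ?thesis by simp
  next
    case False
    then obtain z where z: "x < z" "z < y" "f z = 0" by auto
    define n where "n = zero_order f z"
    obtain e s where e: "e > 0" "s \<noteq> 0"
      "\<And>t. t \<noteq> z \<Longrightarrow> \<bar>t - z\<bar> < e \<Longrightarrow> sgn (f t) = s * sgn (t - z) ^ n"
      using sgn_near_zero[OF f finite_order_has_order[OF ord[OF z(3)]]] n_def by metis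
    \<comment> \<open>Half of the smallest distance keeps \<open>z - h\<close> and
      \<open>z + h\<close> both inside the interval and inside the range of the local sign
      formula.\<close>
    define h where "h = min e (min (z - x) (y - z)) / 2"
    have h: "0 < h" "h < e" "x < z - h" "z + h < y"
      using e(1) z unfolding h_def by (auto simp: min_def field_simps)
    have nz: "f t \<noteq> 0" if "z - h \<le> t" "t \<le> z + h" "t \<noteq> z" for t
    proof -
      have "sgn (f t) \<noteq> 0" using e(2) e(3)[of t] that h by (auto simp: sgn_if)
      then show ?thesis by auto
    qed
    have split: "?Z x y = insert z (?Z x (z - h) \<union> ?Z (z + h) y)"
    proof -
      have "t < z - h \<or> z + h < t" if "f t = 0" "t \<noteq> z" for t
        using nz[of t] that by force
      then show ?thesis using z h by force
    qed
    have notin: "z \<notin> ?Z x (z - h) \<union> ?Z (z + h) y" using h(1) by simp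
    have disjoint: "?Z x (z - h) \<inter> ?Z (z + h) y = {}" using h(1) by auto
    have finite: "finite (?Z x (z - h))" "finite (?Z (z + h) y)"
      using less.prems(4) unfolding split by auto
    have "?Z x (z - h) \<subset> ?Z x y" "?Z (z + h) y \<subset> ?Z x y"
      using notin unfolding split by blast+
    then have card: "card (?Z x (z - h)) < card (?Z x y)" "card (?Z (z + h) y) < card (?Z x y)"
      using psubset_card_mono[OF less.prems(4)] by blast+
    have l: "sgn (f (z - h)) = (-1) ^ (\<Sum>t\<in>?Z x (z - h). zero_order f t) * sgn (f x)"
      using less.hyps[OF card(1)] h finite nz[of "z - h"] less.prems by simp
    have r: "sgn (f y) = (-1) ^ (\<Sum>t\<in>?Z (z + h) y. zero_order f t) * sgn (f (z + h))"
      using less.hyps[OF card(2)] h finite nz[of "z + h"] less.prems by simp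
    have m: "sgn (f (z + h)) = (-1) ^ n * sgn (f (z - h))"
      using e(3)[of "z + h"] e(3)[of "z - h"] h
      by (simp add: power_mult_distrib[symmetric])
    have "(\<Sum>t\<in>?Z x y. zero_order f t) =
      n + ((\<Sum>t\<in>?Z x (z - h). zero_order f t) + (\<Sum>t\<in>?Z (z + h) y. zero_order f t))"
      unfolding split sum.insert[OF finite_UnI[OF finite] notin]
        sum.union_disjoint[OF finite disjoint] n_def ..
    then show ?thesis unfolding r m l by (simp only: power_add mult_ac)
  qed
qed

text \<open>From \<open>a\<close> to \<open>a + T\<close> the sign changes by -1 by antiperiodicity
  and by -1 to the total order by \<open>sgn_zero_count\<close>; comparing the two gives the
  parity.\<close>

lemma antiperiodic_total_zero_order_odd:
  fixes f :: "real \<Rightarrow> real"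
  assumes f: "smooth_on UNIV f" and T: "T > 0" and anti: "\<And>x. f (x + T) = - f x"
    and fin: "\<And>a. finite {x \<in> {a..<a + T}. f x = 0}"
    and ord: "\<And>t. f t = 0 \<Longrightarrow> finite_order f t"
  shows "odd (total_zero_order T f)"
proof -
  \<comment> \<open>A window is infinite but contains finitely many zeros, so some \<open>a\<close>
    is not a zero. Starting there, the open and the half-open window contain the same zeros.\<close>
  have "infinite {0..<0 + T}" using T by (simp add: infinite_Ico)
  then have "\<not> {0..<0 + T} \<subseteq> {x \<in> {0..<0 + T}. f x = 0}"
    using fin[of 0] finite_subset by blast
  then obtain a where a: "f a \<noteq> 0" by blast
  have eq: "{x \<in> {a<..<a + T}. f x = 0} = {x \<in> {a..<a + T}. f x = 0}"
    using a by (auto simp: order_le_less)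
  have "sgn (f (a + T)) = (-1) ^ (\<Sum>t | t \<in> {a<..<a + T} \<and> f t = 0. zero_order f t) * sgn (f a)"
    by (rule sgn_zero_count[OF f]) (use T a anti fin eq ord in auto)
  moreover have "(\<Sum>t | t \<in> {a<..<a + T} \<and> f t = 0. zero_order f t) = total_zero_order T f"
    using total_zero_order_eq[OF T antiperiodic_zeros_descend[OF f anti], of a] eq by simp
  ultimately have "- sgn (f a) = (-1) ^ total_zero_order T f * sgn (f a)"
    by (simp add: anti sgn_minus)
  then show ?thesis using a by (cases "even (total_zero_order T f)") (auto simp: sgn_0_0)
qed

section \<open>Rolle's theorem on a period\<close>

text \<open>Each zero in a window that starts at a zero is sent to a Rolle point before the next
  zero. Since no zero of \<open>f\<close> lies in the interval from \<open>z\<close> (excluded) to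
  \<open>r z\<close> (included), the Rolle points are distinct and avoid \<open>Z\<close>.\<close>

lemma antiperiodic_rolle_points:
  fixes f :: "real \<Rightarrow> real"
  assumes f: "smooth_on UNIV f" and T: "T > 0" and anti: "\<And>x. f (x + T) = - f x"
    and fin: "finite {x \<in> {a..<a + T}. f x = 0}" and a: "f a = 0"
  defines "Z \<equiv> {x \<in> {a..<a + T}. f x = 0}"
  obtains r where "inj_on r Z" "r ` Z \<inter> Z = {}" "r ` Z \<subseteq> {x \<in> {a..<a + T}. deriv f x = 0}"
proof -
  have "\<exists>r. z < r \<and> r < a + T \<and> deriv f r = 0 \<and> (\<forall>t. z < t \<longrightarrow> t \<le> r \<longrightarrow> t \<notin> Z)"
    if z: "z \<in> Z" for z
  proof -
    \<comment> \<open>Adding \<open>a + T\<close>, a zero by antiperiodicity, gives the last zero of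
      the window a successor too.\<close>
    let ?N = "{w \<in> insert (a + T) Z. z < w}"
    define w where "w = Min ?N"
    have N: "finite ?N" "?N \<noteq> {}" using fin z by (auto simp: Z_def)
    have w: "w \<in> ?N" "\<And>v. v \<in> ?N \<Longrightarrow> w \<le> v"
      unfolding w_def using N Min_in[OF N] by (blast, simp)
    have fw: "f z = f w" using w(1) z a anti[of a] by (auto simp: Z_def)
    have "z < w" "w \<le> a + T" using w(1) by (auto simp: Z_def)
    moreover have "\<exists>r>z. r < w \<and> DERIV f r :> 0"
    proof (rule Rolle[OF \<open>z < w\<close> fw])
      show "continuous_on {z..w} f"
        using smooth_on_isCont[OF f] by (auto intro: continuous_at_imp_continuous_on)
      show "f differentiable (at x)" for x
        using smooth_on_has_deriv(1)[OF f] real_differentiable_def by blast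
    qed
    ultimately obtain r where r: "z < r" "r < w" "deriv f r = 0" "r < a + T"
      using DERIV_imp_deriv by force
    moreover have "t \<notin> Z" if "z < t" "t \<le> r" for t
      using w(2)[of t] that r by auto
    ultimately show ?thesis by blast
  qed
  then obtain r where r: "\<And>z. z \<in> Z \<Longrightarrow> z < r z" "\<And>z. z \<in> Z \<Longrightarrow> r z < a + T"
    "\<And>z. z \<in> Z \<Longrightarrow> deriv f (r z) = 0" "\<And>z t. z \<in> Z \<Longrightarrow> z < t \<Longrightarrow> t \<le> r z \<Longrightarrow> t \<notin> Z"
    by metis
  have less: "r z < r z'" if "z \<in> Z" "z' \<in> Z" "z < z'" for z z'
    using r(1)[OF that(2)] r(4)[OF that(1,3)] that(2) by force
  show ?thesis
  proof
    show "inj_on r Z"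
      using less by (metis inj_onI linorder_neqE_linordered_idom less_irrefl)
    show "r ` Z \<inter> Z = {}" using r(1,4) by blast
    show "r ` Z \<subseteq> {x \<in> {a..<a + T}. deriv f x = 0}"
    proof
      fix x assume "x \<in> r ` Z"
      then obtain z where z: "z \<in> Z" "x = r z" by blast
      then have "a \<le> z" by (simp add: Z_def)
      then show "x \<in> {x \<in> {a..<a + T}. deriv f x = 0}" using r(1-3)[OF z(1)] z(2) by simp
    qed
  qed
qed

text \<open>The injection \<open>r\<close> of \<open>Z\<close> into \<open>Z'\<close> gives the
  first inequality. For the second, zeros shared by \<open>f\<close> and \<open>deriv f\<close> and
  the Rolle points form disjoint parts of \<open>Z'\<close> whose orders already add up to
  enough.\<close>

lemma antiperiodic_deriv_zeros:
  fixes f :: "real \<Rightarrow> real"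
  assumes f: "smooth_on UNIV f" and T: "T > 0" and anti: "\<And>x. f (x + T) = - f x"
    and fin: "\<And>a. finite {x \<in> {a..<a + T}. f x = 0}"
    and fin': "\<And>a. finite {x \<in> {a..<a + T}. deriv f x = 0}"
    and ord: "\<And>t. f t = 0 \<Longrightarrow> finite_order f t"
    and ord': "\<And>t. deriv f t = 0 \<Longrightarrow> finite_order (deriv f) t"
  shows "card (zero_classes T f) \<le> card (zero_classes T (deriv f))"
    and "total_zero_order T f \<le> total_zero_order T (deriv f)"
proof -
  \<comment> \<open>Without a zero, \<open>f\<close> would have the same sign at 0 and at
    \<open>T\<close>, against antiperiodicity.\<close>
  have "\<exists>a. f a = 0"
  proof (rule ccontr)
    assume "\<not> ?thesis"
    then have "sgn (f 0) = sgn (f T)" and "f 0 \<noteq> 0"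
      using sgn_eq_if_no_zero[of f 0 T] smooth_on_isCont[OF f] T by auto
    then show False using anti[of 0] by (simp add: sgn_minus sgn_0_0)
  qed
  then obtain a where a: "f a = 0" by blast
  define Z where "Z = {x \<in> {a..<a + T}. f x = 0}"
  define Z' where "Z' = {x \<in> {a..<a + T}. deriv f x = 0}"
  have fZ: "finite Z" "finite Z'" using fin fin' by (simp_all add: Z_def Z'_def)
  obtain r where r: "inj_on r Z" "r ` Z \<inter> Z = {}" "r ` Z \<subseteq> Z'"
    using antiperiodic_rolle_points[OF f T anti fin a] unfolding Z_def Z'_def by blast
  note d = antiperiodic_zeros_descend[OF f anti]
    antiperiodic_zeros_descend[OF smooth_on_has_deriv(2)[OF f] deriv_antiperiodic[OF f anti]]
  show "card (zero_classes T f) \<le> card (zero_classes T (deriv f))"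
    unfolding d[THEN card_zero_classes_eq[OF T, of _ a]]
    using card_inj_on_le[OF r(1,3) fZ(2)] by (simp add: Z_def Z'_def)
  have pos: "1 \<le> zero_order (deriv f) x" if "x \<in> Z'" for x
    using finite_order_has_order[OF ord'[of x]] that
    by (cases "zero_order (deriv f) x") (auto simp: Z'_def has_order_0)
  have "(\<Sum>x\<in>Z. zero_order f x) = (\<Sum>x\<in>Z. zero_order (deriv f) x) + card Z"
    using zero_order_deriv[of f] ord by (simp add: Z_def sum_Suc)
  also have "(\<Sum>x\<in>Z. zero_order (deriv f) x) = (\<Sum>x\<in>Z \<inter> Z'. zero_order (deriv f) x)"
  proof (rule sum.mono_neutral_right[OF fZ(1)])
    show "\<forall>x\<in>Z - Z \<inter> Z'. zero_order (deriv f) x = 0"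
      using has_order_0[of "deriv f"] has_order_imp(2) by (fastforce simp: Z_def Z'_def)
  qed auto
  \<comment> \<open>The lost orders are charged to the Rolle points: there are \<open>card Z\<close>
    of them, each of order at least 1 for \<open>deriv f\<close>.\<close>
  also have "card Z = (\<Sum>x\<in>r ` Z. 1)" using card_image[OF r(1)] by simp
  also have "\<dots> \<le> (\<Sum>x\<in>r ` Z. zero_order (deriv f) x)"
    using r(3) pos by (intro sum_mono) auto
  also have "(\<Sum>x\<in>Z \<inter> Z'. zero_order (deriv f) x) + (\<Sum>x\<in>r ` Z. zero_order (deriv f) x)
      = (\<Sum>x\<in>(Z \<inter> Z') \<union> r ` Z. zero_order (deriv f) x)"
    using fZ r(2) by (intro sum.union_disjoint[symmetric]) auto
  also have "\<dots> \<le> (\<Sum>x\<in>Z'. zero_order (deriv f) x)"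
    using fZ r(3) by (intro sum_mono2) auto
  finally show "total_zero_order T f \<le> total_zero_order T (deriv f)"
    unfolding d[THEN total_zero_order_eq[OF T, of _ a]] by (simp add: Z_def Z'_def)
qed

section \<open>Angle functions\<close>

lemma norm_real_2: "norm (v :: real^2) = sqrt ((v $ 1)\<^sup>2 + (v $ 2)\<^sup>2)"
  by (simp add: norm_vec_def L2_set_def UNIV_2)

lemma unit_dir_nth [simp]: "unit_dir u $ 1 = cos u" "unit_dir u $ 2 = sin u"
  by (simp_all add: unit_dir_def)

lemma unit_dir_nonzero [simp]: "unit_dir u \<noteq> 0"
  using sin_zero_abs_cos_one[of u] by (auto simp: vec_eq_iff forall_2)

lemma real_2_eq_iff: "(v :: real^2) = w \<longleftrightarrow> v $ 1 = w $ 1 \<and> v $ 2 = w $ 2"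
  by (simp add: vec_eq_iff forall_2)

text \<open>Near \<open>u\<close> one has \<open>\<phi> v = \<phi> u + arcsin (det (n u) (n v))\<close> for the normalised field
  \<open>n\<close>; so an angle function is differentiable as soon as the field is.\<close>

lemma local_angle_has_deriv:
  assumes ang: "local_angle V U \<phi>" and u: "u \<in> U"
    and V: "(V has_vector_derivative V') (at u)"
  shows "(\<phi> has_real_derivative (V u $ 1 * V' $ 2 - V u $ 2 * V' $ 1) / (norm (V u))\<^sup>2) (at u)"
proof -
  define h where "h v = V u $ 1 * V v $ 2 - V u $ 2 * V v $ 1" for v
  define k where "k v = norm (V u) * norm (V v)" for v
  have U: "open U" "continuous_on U \<phi>" "\<And>v. v \<in> U \<Longrightarrow> V v \<noteq> 0"
    "\<And>v. v \<in> U \<Longrightarrow> V v = norm (V v) *\<^sub>R unit_dir (\<phi> v)"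
    using ang by (auto simp: local_angle_def)
  have comp: "((\<lambda>v. V v $ i) has_real_derivative V' $ i) (at u)" for i
    using bounded_linear.has_vector_derivative[OF bounded_linear_vec_nth V]
    by (simp add: has_real_derivative_iff_has_vector_derivative)
  have h': "(h has_real_derivative (V u $ 1 * V' $ 2 - V u $ 2 * V' $ 1)) (at u)"
    unfolding h_def by (auto intro!: derivative_eq_intros comp)
  have pos: "(V u $ 1)\<^sup>2 + (V u $ 2)\<^sup>2 > 0"
    using U(3)[OF u] by (simp add: real_2_eq_iff sum_power2_gt_zero_iff)
  have "\<exists>c. ((\<lambda>v. sqrt ((V v $ 1)\<^sup>2 + (V v $ 2)\<^sup>2)) has_real_derivative c) (at u)"
    using pos by (auto intro!: exI derivative_eq_intros comp)
  then obtain c where "(k has_real_derivative c) (at u)"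
    unfolding k_def norm_real_2[of "V v" for v] using DERIV_cmult by blast
  moreover have hu: "h u = 0" and ku: "k u = (norm (V u))\<^sup>2"
    by (simp_all add: h_def k_def power2_eq_square)
  \<comment> \<open>Because \<open>h u = 0\<close>, the unspecified derivative \<open>c\<close> of
    \<open>k\<close> drops out of the quotient rule.\<close>
  ultimately have q: "((\<lambda>v. h v / k v) has_real_derivative
      (V u $ 1 * V' $ 2 - V u $ 2 * V' $ 1) / (norm (V u))\<^sup>2) (at u)"
    using DERIV_divide[OF h', of k c] U(3)[OF u] by (simp add: eval_nat_numeral)
  have sin: "sin (\<phi> v - \<phi> u) = h v / k v" if v: "v \<in> U" for v
  proof -
    have "V v $ 1 = norm (V v) * cos (\<phi> v)" "V v $ 2 = norm (V v) * sin (\<phi> v)"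
      "V u $ 1 = norm (V u) * cos (\<phi> u)" "V u $ 2 = norm (V u) * sin (\<phi> u)"
      by (subst U(4), use u v in simp_all)+
    then have "h v = k v * sin (\<phi> v - \<phi> u)"
      unfolding h_def k_def sin_diff by (simp only:) (simp add: algebra_simps)
    then show ?thesis using U(3) u v by (simp add: k_def)
  qed
  have "((\<lambda>v. arcsin (h v / k v) + \<phi> u) has_real_derivative
      (V u $ 1 * V' $ 2 - V u $ 2 * V' $ 1) / (norm (V u))\<^sup>2) (at u)"
    using DERIV_add[OF DERIV_chain2[OF DERIV_arcsin q] DERIV_const[of "\<phi> u"]] hu by simp
  \<comment> \<open>Continuity of \<open>\<phi>\<close> keeps the angle difference below
    \<open>pi / 2\<close> near \<open>u\<close>, where \<open>arcsin\<close> inverts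
    \<open>sin\<close>.\<close>
  moreover have ev: "\<forall>\<^sub>F v in nhds u. arcsin (h v / k v) + \<phi> u = \<phi> v"
  proof -
    have "isCont \<phi> u" using U(1,2) u by (simp add: continuous_on_eq_continuous_at)
    then have "\<forall>\<^sub>F v in nhds u. dist (\<phi> v) (\<phi> u) < pi / 2"
      by (intro tendstoD) (auto simp: isCont_def tendsto_nhds_iff)
    moreover have "\<forall>\<^sub>F v in nhds u. v \<in> U" using U(1) u by (rule eventually_nhds_in_open)
    ultimately show ?thesis
    proof eventually_elim
      case (elim v)
      then have "\<bar>\<phi> v - \<phi> u\<bar> < pi / 2" by (simp only: dist_real_def)
      then have "arcsin (sin (\<phi> v - \<phi> u)) = \<phi> v - \<phi> u"
        by (intro arcsin_sin) linarith+
      then show ?case using sin elim by simp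
    qed
  qed
  ultimately show ?thesis using DERIV_cong_ev[OF refl ev refl] by simp
qed

section \<open>Parallel chords of an oval\<close>

locale oval =
  fixes \<gamma> :: "real \<Rightarrow> real^2" and \<rho> :: "real \<Rightarrow> real"
  assumes oval: "oval_by_tangent_angle \<gamma> \<rho>"
begin

lemma smooth_gamma: "smooth_on UNIV \<gamma>"
  and smooth_rho: "smooth_on UNIV \<rho>"
  and gamma_periodic: "\<gamma> (2 * pi + u) = \<gamma> u"
  and rho_periodic: "\<rho> (2 * pi + u) = \<rho> u"
  and rho_pos: "\<rho> u > 0"
  and gamma_deriv: "(\<gamma> has_vector_derivative \<rho> u *\<^sub>R unit_dir u) (at u)"
  using oval unfolding oval_by_tangent_angle_def add.commute[of "2 * pi" u] by blast+

lemma rho_nonzero [simp]: "\<rho> u \<noteq> 0"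
  using rho_pos[of u] by simp

lemma rho_add_pos: "\<rho> u + \<rho> v > 0"
  using rho_pos[of u] rho_pos[of v] by simp

text \<open>Tangents at parallel points are opposite. Hence the radii of curvature add in the
  chord's derivative and subtract in that of the midpoint.\<close>

lemma gamma_pi_deriv:
  "((\<lambda>v. \<gamma> (v + pi)) has_vector_derivative - \<rho> (u + pi) *\<^sub>R unit_dir u) (at u)"
proof -
  have "((\<lambda>x. x + pi) has_vector_derivative 1) (at u)"
    by (auto intro!: derivative_eq_intros)
  from vector_diff_chain_at[OF this gamma_deriv]
  have "((\<lambda>v. \<gamma> (v + pi)) has_vector_derivative \<rho> (u + pi) *\<^sub>R unit_dir (u + pi)) (at u)"
    by (simp add: o_def)
  moreover have "unit_dir (u + pi) = - unit_dir u"
    by (simp add: real_2_eq_iff)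
  ultimately show ?thesis by simp
qed

lemma chord_deriv:
  "(parallel_chord \<gamma> has_vector_derivative (\<rho> u + \<rho> (u + pi)) *\<^sub>R unit_dir u) (at u)"
  unfolding parallel_chord_def
  using has_vector_derivative_diff[OF gamma_deriv gamma_pi_deriv] by (simp add: scaleR_add_left)

text \<open>The determinant of the chord and the tangent direction; its absolute value is the
  distance between the two parallel tangent lines.\<close>

definition chord_det :: "real \<Rightarrow> real" where
  "chord_det u = parallel_chord \<gamma> u $ 1 * sin u - parallel_chord \<gamma> u $ 2 * cos u"

text \<open>Strict convexity enters here: the distance from the tangent line at \<open>u\<close> increases on
  the arc from \<open>u\<close> to \<open>u + pi\<close>.\<close>

lemma chord_det_pos: "chord_det u > 0"
proof -
  let ?G = "\<lambda>t. cos u * \<gamma> t $ 2 - sin u * \<gamma> t $ 1"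
  have comp: "((\<lambda>v. \<gamma> v $ i) has_real_derivative \<rho> t * unit_dir t $ i) (at t)" for i t
    using bounded_linear.has_vector_derivative[OF bounded_linear_vec_nth gamma_deriv]
    by (simp add: has_real_derivative_iff_has_vector_derivative)
  have G: "(?G has_real_derivative \<rho> t * sin (t - u)) (at t)" for t
    by (auto intro!: derivative_eq_intros comp simp: sin_diff algebra_simps)
  have "?G u < ?G (u + pi)"
  proof (rule DERIV_pos_imp_increasing_open[where f = ?G and a = u and b = "u + pi"])
    show "\<exists>y. (?G has_real_derivative y) (at t) \<and> 0 < y" if "u < t" "t < u + pi" for t
      using G[of t] sin_gt_zero[of "t - u"] rho_pos[of t] that by auto
    show "continuous_on {u..u + pi} ?G"
      using G DERIV_isCont by (intro continuous_at_imp_continuous_on) blast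
  qed simp
  then show ?thesis by (simp add: chord_det_def parallel_chord_def algebra_simps)
qed

lemma chord_nonzero: "parallel_chord \<gamma> u \<noteq> 0"
  using chord_det_pos[of u] by (auto simp: chord_det_def)

lemma smooth_chord_nth: "smooth_on UNIV (\<lambda>u. parallel_chord \<gamma> u $ i)"
  unfolding parallel_chord_def vector_minus_component
  by (intro smooth_on_diff smooth_on_shift[where f = "\<lambda>u. \<gamma> u $ i"] smooth_on_vec_nth smooth_gamma)

lemma smooth_chord_det: "smooth_on UNIV chord_det"
  unfolding chord_det_def by (intro smooth_on_diff smooth_on_intros smooth_chord_nth)

lemma smooth_norm_chord: "smooth_on UNIV (\<lambda>u. norm (parallel_chord \<gamma> u))"
proof -
  have "(parallel_chord \<gamma> u $ 1)\<^sup>2 + (parallel_chord \<gamma> u $ 2)\<^sup>2 > 0" for u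
    using chord_nonzero[of u] by (simp add: real_2_eq_iff sum_power2_gt_zero_iff)
  then show ?thesis
    unfolding norm_real_2 power2_eq_square by (intro smooth_on_intros smooth_chord_nth)
qed

text \<open>The determinant of the chord and its derivative over the squared length of the chord.
  The square is written as a product to match the smoothness closure rules.\<close>

definition chord_angular_speed :: "real \<Rightarrow> real" where
  "chord_angular_speed u =
     (\<rho> u + \<rho> (u + pi)) * chord_det u / (norm (parallel_chord \<gamma> u) * norm (parallel_chord \<gamma> u))"

lemma chord_angular_speed_pos: "chord_angular_speed u > 0"
  unfolding chord_angular_speed_def
  using rho_add_pos chord_det_pos chord_nonzero by simp

lemma smooth_chord_angular_speed: "smooth_on UNIV chord_angular_speed"
  unfolding chord_angular_speed_def
  by (intro smooth_on_divide smooth_on_intros smooth_rho smooth_chord_det smooth_norm_chord)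
    (simp add: chord_nonzero)

lemma chord_angle_deriv:
  assumes "local_angle (parallel_chord \<gamma>) U \<phi>" "u \<in> U"
  shows "(\<phi> has_real_derivative chord_angular_speed u) (at u)"
  using local_angle_has_deriv[OF assms chord_deriv]
  by (simp add: chord_angular_speed_def chord_det_def algebra_simps power2_eq_square)

lemma chord_angle_regular:
  assumes "local_angle (parallel_chord \<gamma>) U \<phi>"
  shows "regular_parameter U \<phi>"
  unfolding regular_parameter_def
  using smooth_on_primitive[OF smooth_chord_angular_speed chord_angle_deriv[OF assms]]
    DERIV_imp_deriv[OF chord_angle_deriv[OF assms]] chord_angular_speed_pos
  by (metis less_irrefl)

text \<open>Here \<open>c\<close> and \<open>s\<close> are the cosine and sine of the angle from the
  chord to the tangent direction. Strict convexity makes \<open>s\<close> positive, so this angle is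
  \<open>arccos (c u)\<close>, which is continuous; subtracting it from the tangent angle
  \<open>u\<close> gives a global chord angle. Its existence lets \<open>css_speed\<close> determine
  the speed.\<close>

lemma chord_angle_exists: "\<exists>\<phi>. local_angle (parallel_chord \<gamma>) UNIV \<phi>"
proof -
  define N where "N u = norm (parallel_chord \<gamma> u)" for u
  define x y where "x u = parallel_chord \<gamma> u $ 1" and "y u = parallel_chord \<gamma> u $ 2" for u
  define c s where "c u = (x u * cos u + y u * sin u) / N u" and "s u = chord_det u / N u" for u
  have N: "N u > 0" "N u * N u = x u * x u + y u * y u" for u
    using chord_nonzero[of u]
    by (simp_all add: N_def) (simp add: x_def y_def norm_real_2 power2_eq_square)
  have s: "s u > 0" for u using N chord_det_pos by (simp add: s_def)
  have prod: "N u * c u = x u * cos u + y u * sin u" "N u * s u = x u * sin u - y u * cos u"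
    and sin2: "sin u * sin u = 1 - cos u * cos u" for u
    using N(1)[of u] sin_squared_eq[of u]
    by (simp_all add: c_def s_def chord_det_def x_def y_def power2_eq_square)
  \<comment> \<open>Lagrange's identity for dot product and determinant, multiplied by the squared
    norm to be free of division.\<close>
  have "(N u * N u) * (c u * c u + s u * s u) = (N u * N u) * 1" for u
    using prod[of u] N(2)[of u] sin2[of u] by algebra
  then have cs: "(c u)\<^sup>2 + (s u)\<^sup>2 = 1" for u
    unfolding power2_eq_square using N(1)[of u] by (metis mult_cancel_left mult_pos_pos less_irrefl)
  have c: "- 1 \<le> c u" "c u \<le> 1" for u
    using cs[of u] abs_le_square_iff[of "c u" 1] zero_le_power2[of "s u"] by (auto simp: abs_le_iff)
  \<comment> \<open>Positivity of \<open>s u\<close> selects the correct square root.\<close>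
  have sin: "sin (arccos (c u)) = s u" for u
    using sin_arccos[OF c] cs[of u] s[of u]
    by (metis add_diff_cancel_left' real_sqrt_abs abs_of_pos)
  have xy: "x u = N u * (cos u * c u + sin u * s u)" "y u = N u * (sin u * c u - cos u * s u)" for u
    using prod[of u] sin2[of u] by algebra+
  have "smooth_on UNIV c"
    unfolding c_def x_def y_def N_def
    by (intro smooth_on_divide smooth_on_intros smooth_chord_nth smooth_norm_chord)
      (simp add: chord_nonzero)
  then have "continuous_on UNIV c"
    using smooth_on_isCont by (intro continuous_at_imp_continuous_on) blast
  then have "continuous_on UNIV (\<lambda>u. u - arccos (c u))"
    using c by (intro continuous_intros) auto
  moreover have "parallel_chord \<gamma> u = norm (parallel_chord \<gamma> u) *\<^sub>R unit_dir (u - arccos (c u))" for u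
    using xy[of u] c sin by (simp add: real_2_eq_iff cos_diff sin_diff x_def y_def N_def)
  ultimately show ?thesis
    unfolding local_angle_def using chord_nonzero by blast
qed

section \<open>The Wigner caustic and the centre symmetry set\<close>

text \<open>This is \<open>exp F\<close>, written without the exponential.\<close>

definition rho_ratio :: "real \<Rightarrow> real" where
  "rho_ratio u = \<rho> u / \<rho> (u + pi)"

lemma rho_ratio_pos: "rho_ratio u > 0"
  using rho_pos by (simp add: rho_ratio_def)

lemma smooth_rho_ratio: "smooth_on UNIV rho_ratio"
  unfolding rho_ratio_def by (intro smooth_on_divide smooth_on_intros smooth_rho) simp

lemma smooth_log_ratio: "smooth_on UNIV (log_ratio \<rho>)"
  unfolding log_ratio_def rho_ratio_def[symmetric]
  by (intro smooth_on_intros smooth_rho_ratio rho_ratio_pos)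

lemma log_ratio_antiperiodic: "log_ratio \<rho> (u + pi) = - log_ratio \<rho> u"
  using rho_pos by (simp add: log_ratio_def rho_periodic ln_div)

lemma log_ratio_eq_0: "log_ratio \<rho> u = 0 \<longleftrightarrow> \<rho> u = \<rho> (u + pi)"
  using rho_pos[of u] rho_pos[of "u + pi"] by (simp add: log_ratio_def ln_div)

lemma deriv_rho_ratio: "deriv rho_ratio u = rho_ratio u * deriv (log_ratio \<rho>) u"
proof -
  have "((\<lambda>u. ln (rho_ratio u)) has_real_derivative deriv rho_ratio u / rho_ratio u) (at u)"
    using rho_ratio_pos[of u] smooth_on_has_deriv(1)[OF smooth_rho_ratio, of u]
    by (auto intro!: derivative_eq_intros)
  then have "deriv (log_ratio \<rho>) u = deriv rho_ratio u / rho_ratio u"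
    unfolding log_ratio_def rho_ratio_def[symmetric] by (rule DERIV_imp_deriv)
  then show ?thesis using rho_ratio_pos[of u] by simp
qed

lemma wigner_deriv:
  "(wigner_caustic \<gamma> has_vector_derivative ((\<rho> u - \<rho> (u + pi)) / 2) *\<^sub>R unit_dir u) (at u)"
proof -
  have "(wigner_caustic \<gamma> has_vector_derivative
      (1/2) *\<^sub>R (\<rho> u *\<^sub>R unit_dir u + - \<rho> (u + pi) *\<^sub>R unit_dir u)) (at u)"
    unfolding wigner_caustic_def
    by (intro bounded_linear.has_vector_derivative[OF bounded_linear_scaleR_right]
        has_vector_derivative_add gamma_deriv gamma_pi_deriv)
  moreover have "(1/2) *\<^sub>R (\<rho> u *\<^sub>R unit_dir u + - \<rho> (u + pi) *\<^sub>R unit_dir u)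
      = ((\<rho> u - \<rho> (u + pi)) / 2) *\<^sub>R unit_dir u"
    by (simp add: real_2_eq_iff field_simps)
  ultimately show ?thesis by simp
qed

text \<open>The tangent direction never vanishes, so the velocity fixes its coefficient; existence,
  uniqueness and the formula for the speed come together.\<close>

lemma wigner_speed_iff: "wigner_speed \<gamma> l \<longleftrightarrow> l = (\<lambda>u. (\<rho> u - \<rho> (u + pi)) / 2)"
proof
  assume l: "wigner_speed \<gamma> l"
  show "l = (\<lambda>u. (\<rho> u - \<rho> (u + pi)) / 2)"
  proof
    fix u
    have "l u *\<^sub>R unit_dir u = ((\<rho> u - \<rho> (u + pi)) / 2) *\<^sub>R unit_dir u"
      using l wigner_deriv vector_derivative_unique_at unfolding wigner_speed_def by blast
    then show "l u = (\<rho> u - \<rho> (u + pi)) / 2"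
      by (simp only: scaleR_cancel_right) simp
  qed
qed (simp add: wigner_speed_def wigner_deriv)

lemma wigner_singular_iff:
  "(wigner_caustic \<gamma> has_vector_derivative 0) (at u) \<longleftrightarrow> log_ratio \<rho> u = 0"
proof
  assume "(wigner_caustic \<gamma> has_vector_derivative 0) (at u)"
  then have "((\<rho> u - \<rho> (u + pi)) / 2) *\<^sub>R unit_dir u = 0"
    by (rule vector_derivative_unique_at[OF wigner_deriv])
  then show "log_ratio \<rho> u = 0" by (simp add: log_ratio_eq_0)
next
  assume "log_ratio \<rho> u = 0"
  then show "(wigner_caustic \<gamma> has_vector_derivative 0) (at u)"
    using wigner_deriv[of u] by (simp add: log_ratio_eq_0)
qed

lemma smooth_wigner_speed: "smooth_on UNIV (\<lambda>u. (\<rho> u - \<rho> (u + pi)) / 2)"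
  by (intro smooth_on_divide smooth_on_diff smooth_on_intros smooth_rho) simp

text \<open>\<open>exp F - 1\<close> vanishes to the same order as \<open>F\<close> because its derivative is \<open>exp F * F'\<close>.\<close>

lemma wigner_speed_order:
  assumes "log_ratio \<rho> u = 0" "has_order (log_ratio \<rho>) u n"
  shows "has_order (\<lambda>u. (\<rho> u - \<rho> (u + pi)) / 2) u n"
proof -
  obtain m where n: "n = Suc m" and m: "has_order (deriv (log_ratio \<rho>)) u m"
    using assms by (cases n) (auto simp: has_order_0 has_order_Suc)
  have "has_order (\<lambda>u. rho_ratio u * deriv (log_ratio \<rho>) u) u m"
    using rho_ratio_pos[of u]
    by (intro has_order_mult smooth_rho_ratio smooth_on_has_deriv smooth_log_ratio m) simp
  moreover have "deriv (\<lambda>u. rho_ratio u - 1) = (\<lambda>u. rho_ratio u * deriv (log_ratio \<rho>) u)"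
    unfolding deriv_rho_ratio[symmetric]
    by (rule ext, rule DERIV_imp_deriv)
      (auto intro!: derivative_eq_intros smooth_on_has_deriv smooth_rho_ratio)
  \<comment> \<open>The value 1 makes \<open>rho_ratio - 1\<close> vanish at \<open>u\<close>, which
    restores the one order split off from \<open>n\<close>.\<close>
  moreover have "rho_ratio u = 1"
    using assms(1) by (simp add: log_ratio_eq_0 rho_ratio_def)
  ultimately have "has_order (\<lambda>u. rho_ratio u - 1) u n"
    unfolding n has_order_Suc by simp
  then have "has_order (\<lambda>u. \<rho> (u + pi) / 2 * (rho_ratio u - 1)) u n"
    by (intro has_order_mult smooth_on_divide smooth_on_diff smooth_on_intros smooth_rho
        smooth_rho_ratio) simp_all
  moreover have "\<rho> (u + pi) / 2 * (rho_ratio u - 1) = (\<rho> u - \<rho> (u + pi)) / 2" for u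
    by (simp add: rho_ratio_def field_simps)
  ultimately show ?thesis by simp
qed

text \<open>The derivative of \<open>1 / (1 + exp F)\<close> with respect to \<open>F\<close>,
  expressed through the radii of curvature.\<close>

definition css_factor :: "real \<Rightarrow> real" where
  "css_factor u = - (\<rho> u * \<rho> (u + pi)) / ((\<rho> u + \<rho> (u + pi)) * (\<rho> u + \<rho> (u + pi)))"

lemma css_factor_neg: "css_factor u < 0"
  unfolding css_factor_def using rho_pos rho_add_pos[of u "u + pi"]
  by (intro divide_neg_pos) auto

lemma smooth_css_factor: "smooth_on UNIV css_factor"
proof -
  have "smooth_on UNIV (\<lambda>u. ((-1) * (\<rho> u * \<rho> (u + pi))) /
      ((\<rho> u + \<rho> (u + pi)) * (\<rho> u + \<rho> (u + pi))))"
    using rho_add_pos[of u "u + pi" for u]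
    by (intro smooth_on_divide smooth_on_intros smooth_rho) (simp add: less_imp_neq[symmetric])
  then show ?thesis unfolding css_factor_def by simp
qed

text \<open>The two tangential contributions cancel, and the chord weight
  \<open>\<rho> (u + pi) / (\<rho> u + \<rho> (u + pi))\<close> equals \<open>1 / (1 + exp F)\<close>.\<close>

lemma css_deriv:
  "(centre_symmetry_set \<gamma> \<rho> has_vector_derivative
     (css_factor u * deriv (log_ratio \<rho>) u) *\<^sub>R parallel_chord \<gamma> u) (at u)"
proof -
  let ?w = "\<lambda>u. \<rho> (u + pi) / (\<rho> u + \<rho> (u + pi))"
  have w: "?w = (\<lambda>u. 1 / (1 + rho_ratio u))"
    by (auto simp: rho_ratio_def field_simps)
  have "1 + rho_ratio u \<noteq> 0" using rho_ratio_pos[of u] by simp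
  then have "(?w has_real_derivative - (deriv rho_ratio u / ((1 + rho_ratio u) * (1 + rho_ratio u)))) (at u)"
    unfolding w
    by (auto intro!: derivative_eq_intros smooth_on_has_deriv[OF smooth_rho_ratio])
  moreover have "- (deriv rho_ratio u / ((1 + rho_ratio u) * (1 + rho_ratio u)))
      = css_factor u * deriv (log_ratio \<rho>) u"
  proof -
    have "rho_ratio u / ((1 + rho_ratio u) * (1 + rho_ratio u)) = - css_factor u"
      using rho_add_pos[of u "u + pi"] rho_pos[of u] rho_pos[of "u + pi"]
      by (simp add: rho_ratio_def css_factor_def divide_simps) (simp add: algebra_simps)
    then have "css_factor u = - (rho_ratio u / ((1 + rho_ratio u) * (1 + rho_ratio u)))" by simp
    then show ?thesis
      by (simp add: deriv_rho_ratio)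
  qed
  ultimately have w': "(?w has_real_derivative css_factor u * deriv (log_ratio \<rho>) u) (at u)"
    by simp
  have "?w u * (\<rho> u + \<rho> (u + pi)) = \<rho> (u + pi)"
    using rho_add_pos[of u "u + pi"] by simp
  then show ?thesis
    unfolding centre_symmetry_set_def
    using has_vector_derivative_add[OF gamma_pi_deriv
        has_vector_derivative_scaleR[OF w' chord_deriv]]
    by (simp add: scaleR_scaleR)
qed

lemma css_singular_iff:
  "(centre_symmetry_set \<gamma> \<rho> has_vector_derivative 0) (at u) \<longleftrightarrow> deriv (log_ratio \<rho>) u = 0"
proof
  assume "(centre_symmetry_set \<gamma> \<rho> has_vector_derivative 0) (at u)"
  then have "(css_factor u * deriv (log_ratio \<rho>) u) *\<^sub>R parallel_chord \<gamma> u = 0"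
    by (rule vector_derivative_unique_at[OF css_deriv])
  then show "deriv (log_ratio \<rho>) u = 0"
    using css_factor_neg[of u] chord_nonzero[of u] by simp
next
  assume "deriv (log_ratio \<rho>) u = 0"
  then show "(centre_symmetry_set \<gamma> \<rho> has_vector_derivative 0) (at u)"
    using css_deriv[of u] by simp
qed

text \<open>Obtained from \<open>css_deriv\<close> by normalising the chord to unit length and
  passing from \<open>u\<close> to the chord angle as parameter.\<close>

definition css_speed_factor :: "real \<Rightarrow> real" where
  "css_speed_factor u = css_factor u * norm (parallel_chord \<gamma> u) / chord_angular_speed u"

lemma css_speed_factor_nonzero: "css_speed_factor u \<noteq> 0"
  unfolding css_speed_factor_def
  using css_factor_neg[of u] chord_nonzero[of u] chord_angular_speed_pos[of u] by simp

lemma smooth_css_speed_factor: "smooth_on UNIV css_speed_factor"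
  unfolding css_speed_factor_def using chord_angular_speed_pos
  by (intro smooth_on_divide smooth_on_intros smooth_css_factor smooth_norm_chord
      smooth_chord_angular_speed) (simp add: less_imp_neq[symmetric])

text \<open>All local angle functions of the chord have the same derivative, so the speed does not
  depend on their choice; a global one suffices to read it off.\<close>

lemma css_speed_iff:
  "css_speed \<gamma> \<rho> \<sigma> \<longleftrightarrow> \<sigma> = (\<lambda>u. css_speed_factor u * deriv (log_ratio \<rho>) u)"
proof
  assume \<sigma>: "css_speed \<gamma> \<rho> \<sigma>"
  obtain \<phi> where \<phi>: "local_angle (parallel_chord \<gamma>) UNIV \<phi>"
    using chord_angle_exists by blast
  show "\<sigma> = (\<lambda>u. css_speed_factor u * deriv (log_ratio \<rho>) u)"
  proof
    fix u
    let ?\<Delta> = "parallel_chord \<gamma> u"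
    obtain d where d: "(\<phi> has_real_derivative d) (at u)"
      "(centre_symmetry_set \<gamma> \<rho> has_vector_derivative d *\<^sub>R \<sigma> u *\<^sub>R (1 / norm ?\<Delta>) *\<^sub>R ?\<Delta>) (at u)"
      using \<sigma> \<phi> unfolding css_speed_def has_derivative_wrt_def by blast
    have "d = chord_angular_speed u"
      using DERIV_unique[OF d(1) chord_angle_deriv[OF \<phi>]] by simp
    with vector_derivative_unique_at[OF d(2) css_deriv]
    have "(chord_angular_speed u * \<sigma> u / norm ?\<Delta>) *\<^sub>R ?\<Delta>
        = (css_factor u * deriv (log_ratio \<rho>) u) *\<^sub>R ?\<Delta>" by simp
    then have "chord_angular_speed u * \<sigma> u / norm ?\<Delta> = css_factor u * deriv (log_ratio \<rho>) u"
      using chord_nonzero[of u] by (simp only: scaleR_cancel_right) simp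
    then show "\<sigma> u = css_speed_factor u * deriv (log_ratio \<rho>) u"
      using chord_nonzero[of u] chord_angular_speed_pos[of u]
      by (simp add: css_speed_factor_def field_simps)
  qed
next
  assume \<sigma>: "\<sigma> = (\<lambda>u. css_speed_factor u * deriv (log_ratio \<rho>) u)"
  have "has_derivative_wrt (centre_symmetry_set \<gamma> \<rho>) \<phi>
      (\<sigma> u *\<^sub>R (1 / norm (parallel_chord \<gamma> u)) *\<^sub>R parallel_chord \<gamma> u) u"
    if "local_angle (parallel_chord \<gamma>) U \<phi>" "u \<in> U" for U \<phi> u
    unfolding has_derivative_wrt_def
  proof (intro exI conjI)
    show "chord_angular_speed u \<noteq> 0" using chord_angular_speed_pos[of u] by simp
    then show "(centre_symmetry_set \<gamma> \<rho> has_vector_derivative chord_angular_speed u *\<^sub>R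
        \<sigma> u *\<^sub>R (1 / norm (parallel_chord \<gamma> u)) *\<^sub>R parallel_chord \<gamma> u) (at u)"
      using css_deriv[of u] chord_nonzero[of u] by (simp add: \<sigma> css_speed_factor_def)
  qed (rule chord_angle_deriv[OF that])
  then show "css_speed \<gamma> \<rho> \<sigma>" unfolding css_speed_def by blast
qed

section \<open>Invariance of both parametrisations under exchange of the parallel points\<close>

lemma wigner_periodic: "wigner_caustic \<gamma> (u + pi) = wigner_caustic \<gamma> u"
  by (simp add: wigner_caustic_def gamma_periodic add.commute[of "\<gamma> u"])

text \<open>Translation by \<open>pi\<close> swaps both the end points of the chord and their
  weights. As the weights add up to 1, the point is the same.\<close>

lemma css_periodic: "centre_symmetry_set \<gamma> \<rho> (u + pi) = centre_symmetry_set \<gamma> \<rho> u"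
proof -
  let ?a = "\<rho> u / (\<rho> u + \<rho> (u + pi))" and ?b = "\<rho> (u + pi) / (\<rho> u + \<rho> (u + pi))"
  have "?a + ?b = 1"
    using rho_add_pos[of u "u + pi"] by (simp add: add_divide_distrib[symmetric])
  then have "?a = 1 - ?b" by simp
  then have "\<gamma> u + ?a *\<^sub>R (\<gamma> (u + pi) - \<gamma> u) = \<gamma> (u + pi) + ?b *\<^sub>R (\<gamma> u - \<gamma> (u + pi))"
    by (simp only: scaleR_diff_left scaleR_diff_right) simp
  then show ?thesis
    by (simp add: centre_symmetry_set_def parallel_chord_def gamma_periodic rho_periodic
        add.commute[of "\<rho> (u + pi)"])
qed

end

theorem theorem4p3:
  fixes \<gamma> :: "real \<Rightarrow> real^2" and \<rho> F :: "real \<Rightarrow> real"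
  assumes oval: "oval_by_tangent_angle \<gamma> \<rho>"
    and F: "F = log_ratio \<rho>"
    and fin: "finite (zero_classes (2 * pi) F)"
    and fin': "finite (zero_classes (2 * pi) (deriv F))"
    and ord: "\<forall>u. F u = 0 \<longrightarrow> finite_order F u"
    and ord': "\<forall>u. deriv F u = 0 \<longrightarrow> finite_order (deriv F) u"
  shows
    "(\<forall>u. F (u + pi) = - F u) \<and>
     zeros_descend pi F \<and> zeros_descend pi (deriv F) \<and>
     card (zero_classes pi (deriv F)) \<ge> card (zero_classes pi F) \<and>
     total_zero_order pi (deriv F) \<ge> total_zero_order pi F \<and>
     total_zero_order pi F mod 2 = 1 \<and>
     total_zero_order pi (deriv F) mod 2 = 1 \<and>
     (\<forall>u. wigner_caustic \<gamma> (u + pi) = wigner_caustic \<gamma> u) \<and>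
     (\<forall>u. centre_symmetry_set \<gamma> \<rho> (u + pi) = centre_symmetry_set \<gamma> \<rho> u) \<and>
     zero_classes pi F = singular_classes pi (wigner_caustic \<gamma>) \<and>
     zero_classes pi (deriv F) = singular_classes pi (centre_symmetry_set \<gamma> \<rho>) \<and>
     (\<exists>!l. wigner_speed \<gamma> l) \<and>
     (\<forall>l. wigner_speed \<gamma> l \<longrightarrow>
        smooth_on UNIV l \<and>
        (\<forall>u. F u = 0 \<longrightarrow> finite_order l u \<and> zero_order l u = zero_order F u)) \<and>
     (\<forall>u. \<exists>U \<phi>. u \<in> U \<and> local_angle (parallel_chord \<gamma>) U \<phi>) \<and>
     (\<forall>U \<phi>. local_angle (parallel_chord \<gamma>) U \<phi> \<longrightarrow> regular_parameter U \<phi>) \<and>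
     (\<exists>!\<sigma>. css_speed \<gamma> \<rho> \<sigma>) \<and>
     (\<forall>\<sigma>. css_speed \<gamma> \<rho> \<sigma> \<longrightarrow>
        smooth_on UNIV \<sigma> \<and>
        (\<forall>u. deriv F u = 0 \<longrightarrow> finite_order \<sigma> u \<and> zero_order \<sigma> u = zero_order (deriv F) u))"
proof -
  interpret oval \<gamma> \<rho> by unfold_locales (rule oval)
  note smooth = smooth_log_ratio[folded F]
  note anti = log_ratio_antiperiodic[folded F]
  note smooth' = smooth_on_has_deriv(2)[OF smooth]
  note anti' = deriv_antiperiodic[OF smooth anti]
  \<comment> \<open>The hypotheses count zeros modulo \<open>2 * pi\<close>; a window of length
    \<open>pi\<close> lies in the one of double length with the same left end.\<close>
  have finite: "finite {x \<in> {a..<a + pi}. F x = 0}" "finite {x \<in> {a..<a + pi}. deriv F x = 0}" for a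
    by (rule finite_subset[OF _ finite_zeros[OF _ fin, of a]]
        finite_subset[OF _ finite_zeros[OF _ fin', of a]], auto)+
  note zeros = antiperiodic_deriv_zeros[OF smooth pi_gt_zero anti finite
      ord[rule_format] ord'[rule_format]]
  have odd: "odd (total_zero_order pi F)" "odd (total_zero_order pi (deriv F))"
    using antiperiodic_total_zero_order_odd[OF smooth pi_gt_zero anti finite(1) ord[rule_format]]
      antiperiodic_total_zero_order_odd[OF smooth' pi_gt_zero anti' finite(2) ord'[rule_format]]
    by blast+
  have wigner: "smooth_on UNIV l \<and> (\<forall>u. F u = 0 \<longrightarrow> finite_order l u \<and> zero_order l u = zero_order F u)"
    if "wigner_speed \<gamma> l" for l
    using that smooth_wigner_speed wigner_speed_order[folded F, OF _ finite_order_has_order] ord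
    unfolding wigner_speed_iff by (blast intro: has_order_imp)
  have css: "smooth_on UNIV \<sigma> \<and>
      (\<forall>u. deriv F u = 0 \<longrightarrow> finite_order \<sigma> u \<and> zero_order \<sigma> u = zero_order (deriv F) u)"
    if "css_speed \<gamma> \<rho> \<sigma>" for \<sigma>
  proof -
    have \<sigma>: "\<sigma> = (\<lambda>u. css_speed_factor u * deriv F u)"
      using that unfolding css_speed_iff F .
    have "has_order \<sigma> u (zero_order (deriv F) u)" if "deriv F u = 0" for u
      unfolding \<sigma> using that ord'
      by (intro has_order_mult smooth_css_speed_factor smooth' css_speed_factor_nonzero
          finite_order_has_order) blast
    then have "\<forall>u. deriv F u = 0 \<longrightarrow> finite_order \<sigma> u \<and> zero_order \<sigma> u = zero_order (deriv F) u"
      using has_order_imp by blast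
    moreover have "smooth_on UNIV \<sigma>"
      unfolding \<sigma> by (intro smooth_on_intros smooth_css_speed_factor smooth')
    ultimately show ?thesis by blast
  qed
  have singular: "zero_classes pi F = singular_classes pi (wigner_caustic \<gamma>)"
    "zero_classes pi (deriv F) = singular_classes pi (centre_symmetry_set \<gamma> \<rho>)"
    by (simp_all add: zero_classes_def singular_classes_def wigner_singular_iff css_singular_iff F)
  have unique: "\<exists>!l. wigner_speed \<gamma> l" "\<exists>!\<sigma>. css_speed \<gamma> \<rho> \<sigma>"
    unfolding wigner_speed_iff css_speed_iff by simp_all
  have angle: "\<forall>u. \<exists>U \<phi>. u \<in> U \<and> local_angle (parallel_chord \<gamma>) U \<phi>"
    using chord_angle_exists by blast
  show ?thesis
    using anti antiperiodic_zeros_descend[OF smooth anti] antiperiodic_zeros_descend[OF smooth' anti']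
      zeros odd[unfolded odd_iff_mod_2_eq_one] wigner_periodic css_periodic singular unique
      wigner css angle chord_angle_regular
    by (intro conjI) blast+
qed

end
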